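(* Let $A$ be an $n\times n$ nonsingular integer matrix. Then the algebraic entropy of the (projective) monomial map from $\mathbb{CP}^n$ to itself associated with $A$ is equal to the logarithm of an algebraic integer.
   Context: Monomial maps. A nonsingular integer matrix $A=(a_{ij})_{i,j=1}^n$ determines the affine monomial map $(x_1,\dots,x_n)\mapsto(y_1,\dots,y_n)$, $y_i=\prod_j x_j^{a_{ij}}$, on a dense open subset of $\mathbb C^n$. The monomial map $f$ from $\mathbb{CP}^n$ to itself associated with $A$ is its projectivization, obtained from $(x_1:\dots:x_{n+1})\mapsto(y_1:\dots:y_n:1)$ with $y_i=\prod_j (x_j/x_{n+1})^{a_{ij}}$ by clearing denominators and removing common factors. The degree of a rational map from $\mathbb{CP}^n$ to itself is the common degree of its components when written as homogeneous polynomials of the same degree with no joint common factor. The algebraic entropy of $f$ is $\lim_{N\to\infty}\frac1N\log\deg(f^N)$, where $f^N$ is the $N$-fold composition, written with common factors removed (rational maps agreeing on a Zariski-dense set are identified). The limit exists. *)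

theory Defs
  imports
    Complex_Main
    "HOL-Library.Poly_Mapping"
    "Jordan_Normal_Form.Determinant"
begin

section \<open>Polynomials over the complex numbers in the variables \<open>x\<^sub>0, x\<^sub>1, \<dots>\<close>\<close>

text \<open>
  Exponent vectors are finitely supported functions \<open>nat \<Rightarrow>\<^sub>0 nat\<close>; the library multiplication on
  \<open>\<Rightarrow>\<^sub>0\<close> is convolution, i.e. multiplication of polynomials.
\<close>

type_synonym cpoly = "(nat \<Rightarrow>\<^sub>0 nat) \<Rightarrow>\<^sub>0 complex"

definition PVar :: "nat \<Rightarrow> cpoly" where
  "PVar v = Poly_Mapping.single (Poly_Mapping.single v 1) 1"

definition PConst :: "complex \<Rightarrow> cpoly" where
  "PConst c = Poly_Mapping.single 0 c"

definition mon_degree :: "(nat \<Rightarrow>\<^sub>0 nat) \<Rightarrow> nat" where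
  "mon_degree m = (\<Sum>v\<in>Poly_Mapping.keys m. Poly_Mapping.lookup m v)"

text \<open>The zero polynomial is homogeneous of every degree.\<close>

definition homogeneous_of_degree :: "nat \<Rightarrow> cpoly \<Rightarrow> bool" where
  "homogeneous_of_degree d p \<longleftrightarrow> (\<forall>m\<in>Poly_Mapping.keys p. mon_degree m = d)"

definition in_vars :: "nat set \<Rightarrow> cpoly \<Rightarrow> bool" where
  "in_vars V p \<longleftrightarrow> (\<forall>m\<in>Poly_Mapping.keys p. Poly_Mapping.keys m \<subseteq> V)"

definition psubst :: "(nat \<Rightarrow> cpoly) \<Rightarrow> cpoly \<Rightarrow> cpoly" where
  "psubst G p = (\<Sum>m\<in>Poly_Mapping.keys p. PConst (Poly_Mapping.lookup p m) *
                   (\<Prod>v\<in>Poly_Mapping.keys m. G v ^ Poly_Mapping.lookup m v))"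

definition peval :: "(nat \<Rightarrow> complex) \<Rightarrow> cpoly \<Rightarrow> complex" where
  "peval x p = (\<Sum>m\<in>Poly_Mapping.keys p. Poly_Mapping.lookup p m *
                   (\<Prod>v\<in>Poly_Mapping.keys m. x v ^ Poly_Mapping.lookup m v))"


section \<open>Rational self-maps of complex projective \<open>n\<close>-space\<close>

text \<open>
  The homogeneous coordinates are \<open>x\<^sub>0, \<dots>, x\<^sub>n\<close>. A rational map is given by a tuple
  \<open>F 0, \<dots>, F n\<close> of homogeneous polynomials of one degree, not all zero; the values \<open>F i\<close>
  with \<open>i > n\<close> are irrelevant. Proportional tuples (those that agree wherever neither of them is
  \<open>(0, \<dots>, 0)\<close>) give the same rational map.
\<close>

definition ratmap_tuple :: "nat \<Rightarrow> nat \<Rightarrow> (nat \<Rightarrow> cpoly) \<Rightarrow> bool" where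
  "ratmap_tuple n d F \<longleftrightarrow>
     (\<forall>i\<le>n. homogeneous_of_degree d (F i) \<and> in_vars {..n} (F i)) \<and> (\<exists>i\<le>n. F i \<noteq> 0)"

definition same_ratmap :: "nat \<Rightarrow> (nat \<Rightarrow> cpoly) \<Rightarrow> (nat \<Rightarrow> cpoly) \<Rightarrow> bool" where
  "same_ratmap n F G \<longleftrightarrow> (\<forall>i\<le>n. \<forall>j\<le>n. F i * G j = F j * G i)"

definition no_common_factor :: "nat \<Rightarrow> (nat \<Rightarrow> cpoly) \<Rightarrow> bool" where
  "no_common_factor n F \<longleftrightarrow> (\<forall>h. (\<forall>i\<le>n. h dvd F i) \<longrightarrow> h dvd 1)"

text \<open>The tuple \<open>F\<close> itself may have common factors; \<open>G\<close> is \<open>F\<close> with these removed.\<close>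

definition ratmap_degree :: "nat \<Rightarrow> (nat \<Rightarrow> cpoly) \<Rightarrow> nat" where
  "ratmap_degree n F =
     (THE d. \<exists>G. ratmap_tuple n d G \<and> same_ratmap n F G \<and> no_common_factor n G)"

text \<open>
  The composite of two rational maps is defined only if the substituted tuple is not identically
  zero; this always holds if the inner map is dominant, as the monomial maps with
  \<open>det A \<noteq> 0\<close> are.
\<close>

definition ratmap_comp :: "(nat \<Rightarrow> cpoly) \<Rightarrow> (nat \<Rightarrow> cpoly) \<Rightarrow> nat \<Rightarrow> cpoly" where
  "ratmap_comp F G = (\<lambda>i. psubst G (F i))"

definition ratmap_iter :: "(nat \<Rightarrow> cpoly) \<Rightarrow> nat \<Rightarrow> nat \<Rightarrow> cpoly" where
  "ratmap_iter F N = (ratmap_comp F ^^ N) PVar"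

definition has_algebraic_entropy :: "nat \<Rightarrow> (nat \<Rightarrow> cpoly) \<Rightarrow> real \<Rightarrow> bool" where
  "has_algebraic_entropy n F h \<longleftrightarrow>
     (\<lambda>N. ln (real (ratmap_degree n (ratmap_iter F N))) / real N) \<longlonglongrightarrow> h"


section \<open>Monomial maps\<close>

text \<open>
  With rows and columns of \<open>A\<close> indexed from \<open>0\<close>, the last homogeneous coordinate \<open>x\<^sub>n\<close> is the
  homogenizing one. The \<open>i\<close>-th entry of \<open>(y\<^sub>0 : \<dots> : y\<^sub>n\<^sub>-\<^sub>1 : 1)\<close>, where \<open>y\<^sub>i\<close> is the product of the
  \<open>(x\<^sub>j / x\<^sub>n)\<close> to the power \<open>A $$ (i, j)\<close>, is the Laurent monomial whose exponent of \<open>x\<^sub>v\<close> is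
  \<open>laurent_exp n A i v\<close>. The least common denominator of the entries has exponent
  \<open>denom_exp n A v\<close> at \<open>x\<^sub>v\<close>.
\<close>

definition laurent_exp :: "nat \<Rightarrow> int mat \<Rightarrow> nat \<Rightarrow> nat \<Rightarrow> int" where
  "laurent_exp n A i v =
     (if i < n then (if v < n then A $$ (i, v) else - (\<Sum>j<n. A $$ (i, j))) else 0)"

definition denom_exp :: "nat \<Rightarrow> int mat \<Rightarrow> nat \<Rightarrow> nat" where
  "denom_exp n A v = Max ((\<lambda>i. nat (- laurent_exp n A i v)) ` {..n})"

definition monomial_map :: "nat \<Rightarrow> int mat \<Rightarrow> nat \<Rightarrow> cpoly" where
  "monomial_map n A i = (\<Prod>v\<le>n. PVar v ^ nat (laurent_exp n A i v + int (denom_exp n A v)))"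

lemma denom_exp_ge: "i \<le> n \<Longrightarrow> 0 \<le> laurent_exp n A i v + int (denom_exp n A v)"
proof -
  assume "i \<le> n"
  then have "nat (- laurent_exp n A i v) \<le> denom_exp n A v"
    unfolding denom_exp_def by (intro Max_ge) auto
  then show ?thesis by linarith
qed

lemma PVar_power: "PVar v ^ k = Poly_Mapping.single (Poly_Mapping.single v k) 1"
  by (induction k) (simp_all add: PVar_def mult_single flip: single_add)

lemma prod_PVar_power:
  assumes "finite V"
  shows "(\<Prod>v\<in>V. PVar v ^ k v) = Poly_Mapping.single (\<Sum>v\<in>V. Poly_Mapping.single v (k v)) 1"
  using assms by (induction V rule: finite_induct) (simp_all add: PVar_power mult_single)

lemma lookup_sum_single:
  fixes k :: "nat \<Rightarrow> nat"
  assumes "finite V"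
  shows "Poly_Mapping.lookup (\<Sum>v\<in>V. Poly_Mapping.single v (k v)) u = (if u \<in> V then k u else 0)"
  using assms by (simp add: lookup_sum lookup_single when_def)

lemma keys_sum_single:
  fixes k :: "nat \<Rightarrow> nat"
  assumes "finite V"
  shows "Poly_Mapping.keys (\<Sum>v\<in>V. Poly_Mapping.single v (k v)) = {v \<in> V. k v \<noteq> 0}"
  using lookup_sum_single[OF assms] by (auto simp: in_keys_iff split: if_splits)

lemma peval_prod_PVar_power:
  assumes "finite V"
  shows "peval x (\<Prod>v\<in>V. PVar v ^ k v) = (\<Prod>v\<in>V. x v ^ k v)"
proof -
  have "(\<Prod>v\<in>{v \<in> V. k v \<noteq> 0}. x v ^ (if v \<in> V then k v else 0)) = (\<Prod>v\<in>V. x v ^ k v)"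
    by (intro prod.mono_neutral_cong_left) (use assms in auto)
  then show ?thesis
    using assms by (simp add: prod_PVar_power peval_def keys_sum_single lookup_sum_single)
qed

lemma ratmap_tuple_monomial_map:
  "ratmap_tuple n (\<Sum>v\<le>n. denom_exp n A v) (monomial_map n A)"
proof -
  have deg: "(\<Sum>v\<le>n. nat (laurent_exp n A i v + int (denom_exp n A v))) = (\<Sum>v\<le>n. denom_exp n A v)"
    if "i \<le> n" for i
  proof -
    have zero: "(\<Sum>v\<le>n. laurent_exp n A i v) = 0"
      unfolding lessThan_Suc_atMost[symmetric] by (simp add: laurent_exp_def)
    have "int (\<Sum>v\<le>n. nat (laurent_exp n A i v + int (denom_exp n A v))) =
            (\<Sum>v\<le>n. laurent_exp n A i v + int (denom_exp n A v))"
      using that by (simp add: denom_exp_ge)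
    also have "\<dots> = int (\<Sum>v\<le>n. denom_exp n A v)"
      by (simp add: sum.distrib zero)
    finally show ?thesis by linarith
  qed
  have mdeg: "mon_degree (\<Sum>v\<le>n. Poly_Mapping.single v (k v)) = (\<Sum>v\<le>n. k v)" for k
  proof -
    have "(\<Sum>v\<in>{v \<in> {..n}. k v \<noteq> 0}. if v \<in> {..n} then k v else 0) = (\<Sum>v\<in>{..n}. k v)"
      by (intro sum.mono_neutral_cong_left) auto
    then show ?thesis
      by (simp add: mon_degree_def keys_sum_single lookup_sum_single)
  qed
  have "Poly_Mapping.single m (1 :: complex) \<noteq> 0" for m :: "nat \<Rightarrow>\<^sub>0 nat"
    by (metis lookup_single_eq lookup_zero zero_neq_one)
  then show ?thesis
    unfolding ratmap_tuple_def homogeneous_of_degree_def in_vars_def monomial_map_def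
    by (auto simp: prod_PVar_power mdeg deg keys_sum_single)
qed

text \<open>
  On the torus the tuple represents the point \<open>(y\<^sub>0 : \<dots> : y\<^sub>n\<^sub>-\<^sub>1 : 1)\<close>.
\<close>

lemma peval_monomial_map:
  assumes x: "\<And>v. v \<le> n \<Longrightarrow> x v \<noteq> 0"
  shows "\<exists>c. c \<noteq> 0 \<and> (\<forall>i\<le>n. peval x (monomial_map n A i) =
           c * (if i < n then \<Prod>j<n. (x j / x n) powi (A $$ (i, j)) else 1))"
proof (intro exI conjI allI impI)
  let ?c = "\<Prod>v\<le>n. x v ^ denom_exp n A v"
  show "?c \<noteq> 0" using x by auto
  fix i assume i: "i \<le> n"
  have "peval x (monomial_map n A i) =
          (\<Prod>v\<le>n. x v ^ nat (laurent_exp n A i v + int (denom_exp n A v)))"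
    unfolding monomial_map_def by (rule peval_prod_PVar_power) simp
  also have "\<dots> = (\<Prod>v\<le>n. x v ^ denom_exp n A v * x v powi laurent_exp n A i v)"
  proof (intro prod.cong refl)
    fix v assume "v \<in> {..n}"
    then have "x v ^ nat (laurent_exp n A i v + int (denom_exp n A v)) =
                 x v powi (laurent_exp n A i v + int (denom_exp n A v))"
      using denom_exp_ge[OF i] by (simp add: power_int_def)
    then show "x v ^ nat (laurent_exp n A i v + int (denom_exp n A v)) =
                 x v ^ denom_exp n A v * x v powi laurent_exp n A i v"
      using x \<open>v \<in> {..n}\<close> by (simp add: power_int_add)
  qed
  also have "\<dots> = ?c * (\<Prod>v\<le>n. x v powi laurent_exp n A i v)"
    by (simp add: prod.distrib)
  also have "(\<Prod>v\<le>n. x v powi laurent_exp n A i v) =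
      (if i < n then \<Prod>j<n. (x j / x n) powi (A $$ (i, j)) else 1)"
  proof (cases "i < n")
    case True
    have pw: "x n powi (\<Sum>j\<in>J. A $$ (i, j)) = (\<Prod>j\<in>J. x n powi (A $$ (i, j)))"
      if "finite J" for J
      using that by (induction J rule: finite_induct) (simp_all add: power_int_add x)
    show ?thesis
      unfolding lessThan_Suc_atMost[symmetric] using True
      by (simp add: laurent_exp_def power_int_minus pw power_int_divide_distrib prod_dividef
            flip: divide_inverse)
  qed (simp add: laurent_exp_def)
  finally show "peval x (monomial_map n A i) =
      ?c * (if i < n then \<Prod>j<n. (x j / x n) powi (A $$ (i, j)) else 1)" .
qed

end

theory Submission
  imports Defs "Jordan_Normal_Form.Spectral_Radius"
begin

text \<open>
  The entropy is the logarithm of the spectral radius of \<open>A\<close>, and this spectral radius is an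
  algebraic integer.

  The composition of monomial maps corresponds to the multiplication of their matrices, so the
  \<open>N\<close>-th iterate is the monomial map of \<open>A\<^sup>N\<close> once common factors are removed. The tuple
  \<open>monomial_map n (A\<^sup>N)\<close> consists of monomials that have no variable in common, and it is already
  reduced: a divisor of a monomial is a monomial up to a constant. Its degree, the sum of the
  denominator exponents of \<open>A\<^sup>N\<close>, is therefore the degree of the iterate
  (\<open>ratmap_degree_iter_monomial_map\<close>).

  That sum is comparable with the largest absolute value of an entry of \<open>A\<^sup>N\<close>, up to factors that
  depend on \<open>n\<close> only (\<open>laurent_exp_le_sum_denom\<close>, \<open>sum_denom_le\<close>). An eigenvector for a dominant
  eigenvalue bounds the entries of \<open>A\<^sup>N\<close> from below by a multiple of the \<open>N\<close>-th power of the
  spectral radius. The Jordan normal form gives the same bound from above with a polynomial factor.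
  So the degrees grow exponentially, and the rate is the spectral radius, which is positive as \<open>A\<close>
  is nonsingular.

  The spectral radius is the square root of \<open>l * cnj l\<close> for some eigenvalue \<open>l\<close>. This product is an
  eigenvalue of the Kronecker square of \<open>A\<close>, hence a root of the characteristic polynomial
  of an integer matrix, which is monic with integer coefficients
  (\<open>algebraic_int_spectral_radius\<close>).
\<close>

section \<open>Divisors of monomials\<close>

text \<open>
  If an exponent can be reached in only one way as a sum of exponents of the two factors, then no
  cancellation can occur at it in the product. This is used at extreme exponents and, below, for
  a factor with a single term.
\<close>

lemma lookup_mult_unique:
  fixes f g :: "'a::monoid_add \<Rightarrow>\<^sub>0 'b::semiring_0"
  assumes uniq: "\<And>a' b'. a' \<in> Poly_Mapping.keys f \<Longrightarrow> b' \<in> Poly_Mapping.keys g \<Longrightarrow> a' + b' = a + b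
      \<Longrightarrow> a' = a \<and> b' = b"
  shows "Poly_Mapping.lookup (f * g) (a + b) = Poly_Mapping.lookup f a * Poly_Mapping.lookup g b"
proof -
  have "Poly_Mapping.lookup f l * (\<Sum>q. Poly_Mapping.lookup g q when a + b = l + q) =
      (Poly_Mapping.lookup f a * Poly_Mapping.lookup g b when l = a)" for l
  proof (cases "l \<in> Poly_Mapping.keys f")
    case True
    have "(Poly_Mapping.lookup g q when a + b = l + q) = (Poly_Mapping.lookup g b when l = a when q = b)" for q
    proof (cases "q \<in> Poly_Mapping.keys g \<and> a + b = l + q")
      case T: True
      then have "l = a \<and> q = b" using uniq[OF True, of q] by metis
      then show ?thesis using T by simp
    next
      case False
      then show ?thesis by (cases "l = a"; cases "q = b") (auto simp: when_def not_in_keys_iff_lookup_eq_zero)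
    qed
    then show ?thesis by (simp only: Sum_any_when_equal mult_when)  (simp add: when_def)
  next
    case False
    then show ?thesis by (cases "l = a") (simp_all add: in_keys_iff)
  qed
  then show ?thesis by (simp add: lookup_mult)
qed

text \<open>
  With respect to a monomial order, the largest and the smallest exponents of a product are the sums
  of the largest, respectively smallest, exponents of the factors. If the product has only one term,
  these sums agree, so in each factor the largest and the smallest exponent agree.
\<close>

lemma factor_of_single:
  fixes h q :: "'a::{ordered_cancel_comm_monoid_add, linorder} \<Rightarrow>\<^sub>0 'b::semiring_no_zero_divisors"
  assumes hq: "h * q = Poly_Mapping.single e c" and c: "c \<noteq> 0"
  shows "\<exists>m m' a. e = m + m' \<and> h = Poly_Mapping.single m a \<and> a \<noteq> 0"
proof -
  define H Q where "H = Poly_Mapping.keys h" and "Q = Poly_Mapping.keys q"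
  have ne: "H \<noteq> {}" "Q \<noteq> {}"
    using hq c unfolding H_def Q_def
    by (metis keys_eq_empty lookup_single_eq lookup_zero mult_zero_left mult_zero_right)+
  have fin: "finite H" "finite Q" by (simp_all add: H_def Q_def)
  (* The product has a nonzero coefficient at an unambiguous sum, so that sum is e. *)
  have extreme: "a + b = e"
    if ab: "a \<in> H" "b \<in> Q"
      and uniq: "\<And>a' b'. a' \<in> H \<Longrightarrow> b' \<in> Q \<Longrightarrow> a' + b' = a + b \<Longrightarrow> a' = a \<and> b' = b" for a b
  proof -
    have "Poly_Mapping.lookup (h * q) (a + b) = Poly_Mapping.lookup h a * Poly_Mapping.lookup q b"
      by (rule lookup_mult_unique) (use uniq in \<open>auto simp: H_def Q_def\<close>)
    also have "\<dots> \<noteq> 0" using ab by (simp add: H_def Q_def in_keys_iff)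
    finally show ?thesis by (auto simp: hq lookup_single when_def split: if_splits)
  qed
  have "Max H + Max Q = e"
  proof (rule extreme)
    fix a b assume "a \<in> H" "b \<in> Q" and eq: "a + b = Max H + Max Q"
    then have le: "a \<le> Max H" "b \<le> Max Q" using fin by auto
    then show "a = Max H \<and> b = Max Q"
      using eq add_strict_mono[of a "Max H" b "Max Q"] add_less_le_mono[of a "Max H" b "Max Q"]
      by (metis add_left_imp_eq add_le_less_mono order_le_less order_less_irrefl)
  qed (use ne fin in auto)
  moreover have "Min H + Min Q = e"
  proof (rule extreme)
    fix a b assume "a \<in> H" "b \<in> Q" and eq: "a + b = Min H + Min Q"
    then have le: "Min H \<le> a" "Min Q \<le> b" using fin by auto
    then show "a = Min H \<and> b = Min Q"
      using eq by (metis add_left_imp_eq add_less_le_mono order_le_less order_less_irrefl)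
  qed (use ne fin in auto)
  ultimately have sum_eq: "Max H + Max Q = Min H + Min Q" by simp
  have "Min H \<le> Max H" "Min Q \<le> Max Q" using ne fin by auto
  then have eq: "Max H = Min H"
    using sum_eq by (metis add_less_le_mono order_le_less order_less_irrefl)
  have single: "a = Max H" if "a \<in> H" for a
  proof (rule antisym)
    show "a \<le> Max H" using that fin by simp
    show "Max H \<le> a" unfolding eq using that fin by simp
  qed
  have mx: "Max H \<in> H" using ne fin by simp
  have "h = Poly_Mapping.single (Max H) (Poly_Mapping.lookup h (Max H))"
  proof (rule poly_mapping_eqI)
    fix a
    show "Poly_Mapping.lookup h a =
        Poly_Mapping.lookup (Poly_Mapping.single (Max H) (Poly_Mapping.lookup h (Max H))) a"
    proof (cases "a = Max H")
      case False
      then have "a \<notin> Poly_Mapping.keys h" using single H_def by blast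
      then show ?thesis using False by (simp add: lookup_single in_keys_iff)
    qed simp
  qed
  moreover have "Poly_Mapping.lookup h (Max H) \<noteq> 0" using mx by (simp add: H_def in_keys_iff)
  ultimately show ?thesis using \<open>Max H + Max Q = e\<close> by metis
qed

lemma single_dvd:
  fixes p :: "'a::cancel_comm_monoid_add \<Rightarrow>\<^sub>0 'b::comm_semiring_1"
  assumes "\<And>m. m \<in> Poly_Mapping.keys p \<Longrightarrow> \<exists>m'. m = e + m'"
  shows "Poly_Mapping.single e 1 dvd p"
proof -
  have "p = (\<Sum>m\<in>Poly_Mapping.keys p. Poly_Mapping.single m (Poly_Mapping.lookup p m))"
    by (rule poly_mapping_eqI) (simp add: lookup_sum lookup_single when_def sum.delta' in_keys_iff)
  also have "Poly_Mapping.single e 1 dvd \<dots>"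
  proof (rule dvd_sum)
    fix m assume "m \<in> Poly_Mapping.keys p"
    then obtain m' where "m = e + m'" using assms by blast
    then have "Poly_Mapping.single m (Poly_Mapping.lookup p m) =
        Poly_Mapping.single e 1 * Poly_Mapping.single m' (Poly_Mapping.lookup p m)"
      by (simp add: mult_single)
    then show "Poly_Mapping.single e 1 dvd Poly_Mapping.single m (Poly_Mapping.lookup p m)" by simp
  qed
  finally show ?thesis .
qed

lemma unit_imp_constant:
  fixes h :: cpoly
  assumes "h dvd 1"
  obtains c where "h = Poly_Mapping.single 0 c" "c \<noteq> 0"
proof -
  from assms obtain q where "h * q = Poly_Mapping.single 0 1" by (metis dvdE single_one)
  from factor_of_single[OF this] obtain m m' a
    where "(0 :: nat \<Rightarrow>\<^sub>0 nat) = m + m'" "h = Poly_Mapping.single m a" "a \<noteq> 0" by auto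
  moreover from this have "m = 0"
    by (metis add_is_0 lookup_add lookup_zero poly_mapping_eqI)
  ultimately show ?thesis using that by auto
qed


section \<open>Power products\<close>

definition exp_vec :: "nat \<Rightarrow> (nat \<Rightarrow> nat) \<Rightarrow> (nat \<Rightarrow>\<^sub>0 nat)" where
  "exp_vec n k = (\<Sum>v\<le>n. Poly_Mapping.single v (k v))"

definition power_product :: "nat \<Rightarrow> (nat \<Rightarrow> nat) \<Rightarrow> cpoly" where
  "power_product n k = (\<Prod>v\<le>n. PVar v ^ k v)"

lemma lookup_exp_vec: "Poly_Mapping.lookup (exp_vec n k) v = (if v \<le> n then k v else 0)"
  by (simp add: exp_vec_def lookup_sum_single)

lemma power_product_eq_single: "power_product n k = Poly_Mapping.single (exp_vec n k) 1"
  by (simp add: power_product_def exp_vec_def prod_PVar_power)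

lemma power_product_neq_0: "power_product n k \<noteq> 0"
  by (metis power_product_eq_single lookup_single_eq lookup_zero zero_neq_one)

lemma power_product_mult: "power_product n k * power_product n l = power_product n (\<lambda>v. k v + l v)"
  by (simp add: power_product_def power_add prod.distrib)

lemma power_product_cong: "(\<And>v. v \<le> n \<Longrightarrow> k v = l v) \<Longrightarrow> power_product n k = power_product n l"
  by (auto simp: power_product_def)

lemma mon_degree_exp_vec: "mon_degree (exp_vec n k) = (\<Sum>v\<le>n. k v)"
proof -
  have "(\<Sum>v\<in>{v \<in> {..n}. k v \<noteq> 0}. if v \<in> {..n} then k v else 0) = (\<Sum>v\<in>{..n}. k v)"
    by (intro sum.mono_neutral_cong_left) auto
  then show ?thesis
    by (simp add: mon_degree_def exp_vec_def keys_sum_single lookup_sum_single)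
qed

text \<open>
  Substitution into a power product does not expand anything. Hence the composite of two tuples of
  power products is again one, and its exponents come from a matrix product
  (\<open>prod_power_product\<close>).
\<close>

lemma psubst_power_product: "psubst G (power_product n k) = (\<Prod>v\<le>n. G v ^ k v)"
proof -
  have "(\<Prod>v\<in>{v \<in> {..n}. k v \<noteq> 0}. G v ^ (if v \<in> {..n} then k v else 0)) = (\<Prod>v\<le>n. G v ^ k v)"
    by (intro prod.mono_neutral_cong_left) auto
  then show ?thesis
    by (simp add: power_product_def prod_PVar_power psubst_def keys_sum_single lookup_sum_single
        PConst_def)
qed

lemma prod_power_product:
  "(\<Prod>v\<le>n. power_product n (e v) ^ k v) = power_product n (\<lambda>w. \<Sum>v\<le>n. k v * e v w)"
proof -
  have "(\<Prod>v\<le>n. power_product n (e v) ^ k v) = (\<Prod>v\<le>n. \<Prod>w\<le>n. PVar w ^ (k v * e v w))"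
    unfolding power_product_def by (simp add: prod_power_distrib mult.commute flip: power_mult)
  also have "\<dots> = (\<Prod>w\<le>n. \<Prod>v\<le>n. PVar w ^ (k v * e v w))" by (rule prod.swap)
  finally show ?thesis by (simp add: power_product_def power_sum)
qed

lemma power_product_PVar: "i \<le> n \<Longrightarrow> PVar i = power_product n (\<lambda>v. if v = i then 1 else 0)"
  by (simp add: power_product_def if_distrib[of "\<lambda>k. _ ^ k"] prod.delta cong: if_cong)

section \<open>The degree of a rational map given by power products\<close>

text \<open>
  A common factor of monomials is a monomial up to a constant, and its exponent lies below all the
  given ones. As each variable is absent from one of the monomials, it is a constant.
\<close>

lemma no_common_factor_power_products:
  assumes min: "\<And>v. v \<le> n \<Longrightarrow> \<exists>i\<le>n. k i v = 0"
  shows "no_common_factor n (\<lambda>i. power_product n (k i))"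
  unfolding no_common_factor_def
proof (intro allI impI)
  fix h :: cpoly assume dvd: "\<forall>i\<le>n. h dvd power_product n (k i)"
  have shape: "\<exists>m m' a. exp_vec n (k i) = m + m' \<and> h = Poly_Mapping.single m a \<and> a \<noteq> 0" if "i \<le> n" for i
  proof -
    have "h dvd power_product n (k i)" using dvd that by blast
    then obtain q where "h * q = Poly_Mapping.single (exp_vec n (k i)) 1"
      unfolding power_product_eq_single by (metis dvdE)
    from factor_of_single[OF this] show ?thesis by simp
  qed
  obtain m a where h: "h = Poly_Mapping.single m a" and a: "a \<noteq> 0" using shape[of 0] by auto
  have le: "Poly_Mapping.lookup m v \<le> Poly_Mapping.lookup (exp_vec n (k i)) v" if i: "i \<le> n" for i v
  proof -
    obtain m1 m2 b where *: "exp_vec n (k i) = m1 + m2" "h = Poly_Mapping.single m1 b" "b \<noteq> 0"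
      using shape[OF i] by blast
    then have "m1 = m" using h a by (metis keys_single singleton_inject)
    then show ?thesis using * by (simp add: lookup_add)
  qed
  have "Poly_Mapping.lookup m v = 0" for v
  proof (cases "v \<le> n")
    case True
    with min obtain i where "i \<le> n" "k i v = 0" by blast
    with le[of i v] True show ?thesis by (simp add: lookup_exp_vec)
  next
    case False
    with le[of 0 v] show ?thesis by (simp add: lookup_exp_vec)
  qed
  then have "m = 0" by (intro poly_mapping_eqI) simp
  then have "h * Poly_Mapping.single 0 (inverse a) = 1" using a by (simp add: h mult_single)
  then show "h dvd 1" by (metis dvdI)
qed

text \<open>
  The representative without common factor divides every other one. Let \<open>P\<^sub>i\<close> be the power
  product of \<open>k i\<close>. Comparing terms in \<open>P\<^sub>i G\<^sub>j = P\<^sub>j G\<^sub>i\<close> shows that every monomial of \<open>G\<^sub>j\<close> has, in each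
  variable \<open>v\<close>, at least the exponent of \<open>P\<^sub>j\<close>: choose \<open>i\<close> such that \<open>P\<^sub>i\<close> does not contain \<open>v\<close>.
  The quotients \<open>G\<^sub>j / P\<^sub>j\<close> then all agree by cancellation.
\<close>

lemma same_ratmap_power_products:
  assumes min: "\<And>v. v \<le> n \<Longrightarrow> \<exists>i\<le>n. k i v = 0"
    and same: "same_ratmap n (\<lambda>i. power_product n (k i)) G"
  obtains h where "\<And>i. i \<le> n \<Longrightarrow> G i = power_product n (k i) * h"
proof -
  have eq: "power_product n (k i) * G j = power_product n (k j) * G i" if "i \<le> n" "j \<le> n" for i j
    using same that by (auto simp: same_ratmap_def)
  have "power_product n (k j) dvd G j" if j: "j \<le> n" for j
    unfolding power_product_eq_single
  proof (rule single_dvd)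
    fix m assume m: "m \<in> Poly_Mapping.keys (G j)"
    have ge: "Poly_Mapping.lookup (exp_vec n (k j)) v
        \<le> Poly_Mapping.lookup (exp_vec n (k i)) v + Poly_Mapping.lookup m v" if i: "i \<le> n" for i v
    proof -
      have "Poly_Mapping.lookup (power_product n (k i) * G j) (exp_vec n (k i) + m) =
          Poly_Mapping.lookup (power_product n (k i)) (exp_vec n (k i)) * Poly_Mapping.lookup (G j) m"
        by (rule lookup_mult_unique) (auto simp: power_product_eq_single)
      also have "\<dots> \<noteq> 0" using m by (simp add: power_product_eq_single in_keys_iff)
      finally have "exp_vec n (k i) + m \<in> Poly_Mapping.keys (power_product n (k j) * G i)"
        by (simp add: eq[OF i j] in_keys_iff)
      with keys_mult obtain b where "exp_vec n (k i) + m = exp_vec n (k j) + b"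
        by (fastforce simp: power_product_eq_single)
      from arg_cong[OF this, of "\<lambda>e. Poly_Mapping.lookup e v"] show ?thesis
        by (simp add: lookup_add)
    qed
    have "Poly_Mapping.lookup (exp_vec n (k j)) v \<le> Poly_Mapping.lookup m v" for v
    proof (cases "v \<le> n")
      case True
      with min obtain i where "i \<le> n" "k i v = 0" by blast
      with ge[of i v] True show ?thesis by (simp add: lookup_exp_vec)
    qed (simp add: lookup_exp_vec)
    then have "m = exp_vec n (k j) + (m - exp_vec n (k j))"
      by (intro poly_mapping_eqI) (simp add: lookup_add lookup_minus)
    then show "\<exists>m'. m = exp_vec n (k j) + m'" ..
  qed
  then have "\<forall>j. \<exists>q. j \<le> n \<longrightarrow> G j = power_product n (k j) * q" by (metis dvdE)
  from choice[OF this] obtain H where H: "\<And>j. j \<le> n \<Longrightarrow> G j = power_product n (k j) * H j" by auto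
  have "H j = H 0" if j: "j \<le> n" for j
  proof -
    have "power_product n (k 0) * (power_product n (k j) * H j) =
        power_product n (k j) * (power_product n (k 0) * H 0)"
      using eq[OF _ j, of 0] unfolding H[OF j] H[OF le0] by blast
    then have "power_product n (k 0) * power_product n (k j) * H j =
        power_product n (k 0) * power_product n (k j) * H 0"
      by (simp only: ac_simps)
    then show ?thesis by (simp only: mult_cancel_left mult_eq_0_iff power_product_neq_0) simp
  qed
  then have "G i = power_product n (k i) * H 0" if "i \<le> n" for i using H[OF that] that by metis
  then show ?thesis by (rule that)
qed

text \<open>
  The degree is defined by a description operator, so uniqueness over all reduced
  representatives has to be shown. A second reduced representative is a multiple \<open>h\<close> of the
  tuple of power products, and \<open>h\<close> is a unit as it divides all entries.
\<close>

lemma ratmap_degree_power_products: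
  assumes min: "\<And>v. v \<le> n \<Longrightarrow> \<exists>i\<le>n. k i v = 0"
    and deg: "\<And>i. i \<le> n \<Longrightarrow> (\<Sum>v\<le>n. k i v) = d"
    and F: "\<And>i. i \<le> n \<Longrightarrow> F i = p * power_product n (k i)" and p: "p \<noteq> 0"
  shows "ratmap_degree n F = d"
  unfolding ratmap_degree_def
proof (rule the_equality)
  let ?P = "\<lambda>i. power_product n (k i)"
  have "ratmap_tuple n d ?P"
    unfolding ratmap_tuple_def
  proof (intro conjI allI impI)
    fix i assume "i \<le> n"
    then show "homogeneous_of_degree d (?P i)"
      by (simp add: homogeneous_of_degree_def power_product_eq_single mon_degree_exp_vec deg)
    show "in_vars {..n} (?P i)"
      by (auto simp: in_vars_def power_product_eq_single exp_vec_def keys_sum_single)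
  qed (use power_product_neq_0 in blast)
  moreover have "same_ratmap n F ?P" by (simp add: same_ratmap_def F ac_simps)
  ultimately show "\<exists>G. ratmap_tuple n d G \<and> same_ratmap n F G \<and> no_common_factor n G"
    using no_common_factor_power_products[of n k] min by blast
next
  let ?P = "\<lambda>i. power_product n (k i)"
  fix d' assume "\<exists>G. ratmap_tuple n d' G \<and> same_ratmap n F G \<and> no_common_factor n G"
  then obtain G where G: "ratmap_tuple n d' G" "same_ratmap n F G" "no_common_factor n G" by blast
  have "?P i * G j = ?P j * G i" if "i \<le> n" "j \<le> n" for i j
  proof -
    have "F i * G j = F j * G i" using G(2) that unfolding same_ratmap_def by blast
    then have "p * (?P i * G j) = p * (?P j * G i)" using that by (simp only: F mult.assoc)
    then show ?thesis using p by simp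
  qed
  then have "same_ratmap n ?P G" unfolding same_ratmap_def by blast
  then obtain h where h: "\<And>i. i \<le> n \<Longrightarrow> G i = ?P i * h"
    using same_ratmap_power_products[of n k] min by blast
  then have "\<forall>i\<le>n. h dvd G i" by (metis dvd_triv_right)
  then have "h dvd 1" using G(3) unfolding no_common_factor_def by blast
  then obtain c where c: "h = Poly_Mapping.single 0 c" "c \<noteq> 0" by (rule unit_imp_constant)
  have "G 0 = Poly_Mapping.single (exp_vec n (k 0)) c"
    by (simp add: h c power_product_eq_single mult_single)
  then have "d' = mon_degree (exp_vec n (k 0))"
    using G(1) c(2) by (auto simp: ratmap_tuple_def homogeneous_of_degree_def)
  then show "d' = d" by (simp add: mon_degree_exp_vec deg)
qed

section \<open>Iterates of monomial maps\<close>

text \<open>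
  The entries of the projectivized map are homogeneous of degree zero.
\<close>

lemma sum_laurent_exp: "i \<le> n \<Longrightarrow> (\<Sum>v\<le>n. laurent_exp n A i v) = 0"
  unfolding lessThan_Suc_atMost[symmetric] by (simp add: laurent_exp_def)

text \<open>
  Passing to Laurent exponents in homogeneous coordinates is compatible with matrix products. This
  is the exponent form of the fact that the monomial map of \<open>A * B\<close> is the map of \<open>A\<close> after that
  of \<open>B\<close>.
\<close>

lemma laurent_exp_mult:
  assumes A: "A \<in> carrier_mat n n" and B: "B \<in> carrier_mat n n" and i: "i \<le> n" and w: "w \<le> n"
  shows "laurent_exp n (A * B) i w = (\<Sum>v\<le>n. laurent_exp n A i v * laurent_exp n B v w)"
proof (cases "i < n")
  case True
  have entry: "(A * B) $$ (i, j) = (\<Sum>v<n. A $$ (i, v) * B $$ (v, j))" if "j < n" for j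
    using A B True that by (simp add: scalar_prod_def lessThan_atLeast0)
  have "laurent_exp n (A * B) i w = (\<Sum>v<n. A $$ (i, v) * laurent_exp n B v w)"
  proof (cases "w < n")
    case False
    have "(\<Sum>j<n. (A * B) $$ (i, j)) = (\<Sum>j<n. \<Sum>v<n. A $$ (i, v) * B $$ (v, j))"
      by (simp add: entry)
    also have "\<dots> = (\<Sum>v<n. A $$ (i, v) * (\<Sum>j<n. B $$ (v, j)))"
      by (subst sum.swap) (simp add: sum_distrib_left)
    finally show ?thesis using True False by (simp add: laurent_exp_def sum_negf)
  qed (use True in \<open>simp add: laurent_exp_def entry\<close>)
  then show ?thesis
    unfolding lessThan_Suc_atMost[symmetric] using True by (simp add: laurent_exp_def)
qed (simp add: laurent_exp_def)

lemma pow_mat_Suc_left: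
  assumes A: "A \<in> carrier_mat n n"
  shows "A ^\<^sub>m Suc N = A * A ^\<^sub>m N"
proof (induction N)
  case 0
  then show ?case using A by simp
next
  case (Suc N)
  have "A ^\<^sub>m Suc (Suc N) = A * A ^\<^sub>m N * A" using Suc by simp
  also have "\<dots> = A * A ^\<^sub>m Suc N" using A by (simp add: assoc_mult_mat[of _ n n _ n _ n])
  finally show ?case .
qed

text \<open>
  The iterated tuple, with its common factors, has the exponents of the map of \<open>A\<^sup>N\<close> up to a shift
  \<open>s\<close> that is the same for all entries. In the step, clearing denominators adds
  \<open>denom_exp n A v\<close> to every row of exponents, which changes the matrix product by a term without
  \<open>i\<close>. The old shift drops out of the rest because the rows of Laurent exponents sum to zero.
\<close>

lemma ratmap_iter_monomial_map:
  assumes A: "A \<in> carrier_mat n n"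
  shows "\<exists>e s. \<forall>i\<le>n. ratmap_iter (monomial_map n A) N i = power_product n (e i) \<and>
      (\<forall>w\<le>n. int (e i w) = laurent_exp n (A ^\<^sub>m N) i w + s w)"
proof (induction N)
  case 0
  (* The identity is (x_0 : ... : x_n), and division by x_n turns its tuple into that of the
     identity matrix; so the shift is the exponent vector of x_n. *)
  show ?case
  proof (intro exI allI impI conjI)
    fix i assume i: "i \<le> n"
    show "ratmap_iter (monomial_map n A) 0 i = power_product n ((\<lambda>i v. if v = i then 1 else 0) i)"
      using i by (simp add: ratmap_iter_def power_product_PVar)
    fix w assume w: "w \<le> n"
    show "int ((\<lambda>i v. if v = i then 1 else 0) i w) =
        laurent_exp n (A ^\<^sub>m 0) i w + (if w = n then 1 else 0)"
      using A i w by (auto simp: laurent_exp_def)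
  qed
next
  case (Suc N)
  let ?L = "laurent_exp n A" and ?B = "A ^\<^sub>m N" and ?d = "denom_exp n A"
  from Suc obtain e s
    where it: "\<And>i. i \<le> n \<Longrightarrow> ratmap_iter (monomial_map n A) N i = power_product n (e i)"
      and e: "\<And>i w. i \<le> n \<Longrightarrow> w \<le> n \<Longrightarrow> int (e i w) = laurent_exp n ?B i w + s w" by blast
  let ?k = "\<lambda>i v. nat (?L i v + int (?d v))"
  let ?e = "\<lambda>i w. \<Sum>v\<le>n. ?k i v * e v w"
  let ?s = "\<lambda>w. \<Sum>v\<le>n. int (?d v) * (laurent_exp n ?B v w + s w)"
  have B: "?B \<in> carrier_mat n n" using A by simp
  show ?case
  proof (intro exI allI impI conjI)
    fix i assume i: "i \<le> n"
    have "ratmap_iter (monomial_map n A) (Suc N) i =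
        psubst (ratmap_iter (monomial_map n A) N) (power_product n (?k i))"
      by (simp add: ratmap_iter_def ratmap_comp_def monomial_map_def power_product_def)
    also have "\<dots> = (\<Prod>v\<le>n. power_product n (e v) ^ ?k i v)"
      by (simp add: psubst_power_product it)
    finally show "ratmap_iter (monomial_map n A) (Suc N) i = power_product n (?e i)"
      by (simp add: prod_power_product)
    fix w assume w: "w \<le> n"
    have "int (?e i w) = (\<Sum>v\<le>n. (?L i v + int (?d v)) * (laurent_exp n ?B v w + s w))"
      using i w by (simp add: denom_exp_ge e)
    also have "\<dots> = (\<Sum>v\<le>n. ?L i v * laurent_exp n ?B v w) + (\<Sum>v\<le>n. ?L i v) * s w + ?s w"
      by (simp add: algebra_simps sum.distrib sum_distrib_left)
    also have "\<dots> = laurent_exp n (A ^\<^sub>m Suc N) i w + ?s w"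
      unfolding pow_mat_Suc_left[OF A] by (simp add: laurent_exp_mult[OF A B i w] sum_laurent_exp[OF i])
    finally show "int (?e i w) = laurent_exp n (A ^\<^sub>m Suc N) i w + ?s w" .
  qed
qed

text \<open>
  Hence no variable divides all entries of a monomial map. If the denominator exponent is zero, the
  constant last coordinate attains it.
\<close>

lemma denom_exp_attained:
  "\<exists>i\<le>n. laurent_exp n A i v + int (denom_exp n A v) = 0"
proof -
  let ?f = "\<lambda>i. nat (- laurent_exp n A i v)"
  have "denom_exp n A v \<in> ?f ` {..n}"
    unfolding denom_exp_def by (intro Max_in) auto
  then obtain i where i: "i \<le> n" "denom_exp n A v = ?f i" by auto
  show ?thesis
  proof (cases "denom_exp n A v = 0")
    case True
    then show ?thesis by (intro exI[of _ n]) (simp add: laurent_exp_def)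
  next
    case False
    then show ?thesis using i by (intro exI[of _ i]) auto
  qed
qed

text \<open>
  The shift in \<open>ratmap_iter_monomial_map\<close> dominates the denominator exponents of \<open>A\<^sup>N\<close>, because
  all exponents of the iterated tuple are natural numbers. The difference is the exponent of the
  greatest common divisor of that tuple.
\<close>

lemma ratmap_degree_iter_monomial_map:
  assumes A: "A \<in> carrier_mat n n"
  shows "ratmap_degree n (ratmap_iter (monomial_map n A) N) = (\<Sum>v\<le>n. denom_exp n (A ^\<^sub>m N) v)"
proof -
  let ?L = "laurent_exp n (A ^\<^sub>m N)" and ?d = "denom_exp n (A ^\<^sub>m N)"
  let ?k = "\<lambda>i v. nat (?L i v + int (?d v))"
  from ratmap_iter_monomial_map[OF A, of N] obtain e s
    where it: "\<And>i. i \<le> n \<Longrightarrow> ratmap_iter (monomial_map n A) N i = power_product n (e i)"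
      and e: "\<And>i w. i \<le> n \<Longrightarrow> w \<le> n \<Longrightarrow> int (e i w) = ?L i w + s w" by blast
  let ?t = "\<lambda>w. nat (s w - int (?d w))"
  have s: "int (?d w) \<le> s w" if "w \<le> n" for w
  proof -
    obtain i where i: "i \<le> n" "?L i w + int (?d w) = 0" using denom_exp_attained by blast
    with e[of i w] that show ?thesis by simp
  qed
  show ?thesis
  proof (rule ratmap_degree_power_products)
    fix v assume "v \<le> n"
    show "\<exists>i\<le>n. ?k i v = 0" using denom_exp_attained[of n "A ^\<^sub>m N" v] by force
  next
    fix i assume i: "i \<le> n"
    have "int (\<Sum>v\<le>n. ?k i v) = (\<Sum>v\<le>n. ?L i v + int (?d v))" using i by (simp add: denom_exp_ge)
    also have "\<dots> = int (\<Sum>v\<le>n. ?d v)" using i by (simp add: sum.distrib sum_laurent_exp)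
    finally show "(\<Sum>v\<le>n. ?k i v) = (\<Sum>v\<le>n. ?d v)" by linarith
  next
    fix i assume i: "i \<le> n"
    have "e i w = ?t w + ?k i w" if "w \<le> n" for w
      using e[OF i that] s[OF that] denom_exp_ge[OF i, of "A ^\<^sub>m N" w] by linarith
    then show "ratmap_iter (monomial_map n A) N i = power_product n ?t * power_product n (?k i)"
      unfolding it[OF i] power_product_mult by (rule power_product_cong)
  qed (rule power_product_neq_0)
qed

section \<open>Comparison of the degree with the entries of the matrix\<close>

text \<open>
  Negative exponents are bounded by the denominator. Since a row of Laurent exponents sums to zero,
  a positive one is balanced by negative ones in the other columns.
\<close>

lemma laurent_exp_le_sum_denom:
  assumes i: "i \<le> n" and v: "v \<le> n"
  shows "\<bar>laurent_exp n B i v\<bar> \<le> int (\<Sum>w\<le>n. denom_exp n B w)"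
proof -
  let ?L = "laurent_exp n B" and ?d = "denom_exp n B"
  have lower: "- ?L i w \<le> int (?d w)" for w using denom_exp_ge[OF i, of B w] by linarith
  have "?L i v = (\<Sum>w\<in>{..n} - {v}. - ?L i w)"
    using sum_laurent_exp[OF i, of B] v by (simp add: sum.remove[of "{..n}" v] sum_negf)
  also have "\<dots> \<le> (\<Sum>w\<in>{..n} - {v}. int (?d w))" by (intro sum_mono lower)
  also have "\<dots> \<le> (\<Sum>w\<le>n. int (?d w))" by (intro sum_mono2) auto
  finally have "?L i v \<le> int (\<Sum>w\<le>n. ?d w)" by simp
  moreover have "- ?L i v \<le> int (\<Sum>w\<le>n. ?d w)"
  proof -
    have "int (?d v) \<le> (\<Sum>w\<le>n. int (?d w))" using v by (intro member_le_sum) auto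
    then show ?thesis using lower[of v] by simp
  qed
  ultimately show ?thesis by linarith
qed

lemma sum_denom_le:
  assumes M: "\<And>i j. i < n \<Longrightarrow> j < n \<Longrightarrow> real_of_int \<bar>B $$ (i, j)\<bar> \<le> M" and n: "n \<ge> 1"
  shows "real (\<Sum>w\<le>n. denom_exp n B w) \<le> real (Suc n) * (real n * M)"
proof -
  have M0: "0 \<le> M" using M[of 0 0] n by linarith
  have MnM: "M \<le> real n * M" using M0 n mult_right_mono[of 1 "real n" M] by simp
  have L: "- real_of_int (laurent_exp n B i v) \<le> real n * M" if "i \<le> n" "v \<le> n" for i v
  proof (cases "i < n")
    case True
    show ?thesis
    proof (cases "v < n")
      case T: True
      have "- real_of_int (laurent_exp n B i v) \<le> M"
        using M[OF True T] True T by (simp add: laurent_exp_def)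
      then show ?thesis using MnM by simp
    next
      case False
      have "- real_of_int (laurent_exp n B i v) = (\<Sum>j<n. real_of_int (B $$ (i, j)))"
        using True False by (simp add: laurent_exp_def)
      also have "\<dots> \<le> (\<Sum>j<n. M)"
      proof (rule sum_mono)
        fix j assume "j \<in> {..<n}"
        then show "real_of_int (B $$ (i, j)) \<le> M" using M[OF True, of j] by simp
      qed
      finally show ?thesis by simp
    qed
  qed (use M0 in \<open>simp add: laurent_exp_def\<close>)
  have "real (denom_exp n B w) \<le> real n * M" if w: "w \<le> n" for w
  proof -
    have "denom_exp n B w \<in> (\<lambda>i. nat (- laurent_exp n B i w)) ` {..n}"
      unfolding denom_exp_def by (intro Max_in) auto
    then obtain i where "i \<le> n" "denom_exp n B w = nat (- laurent_exp n B i w)" by auto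
    then show ?thesis using L[OF _ w, of i] M0 by (cases "laurent_exp n B i w \<le> 0") auto
  qed
  then have "(\<Sum>w\<le>n. real (denom_exp n B w)) \<le> (\<Sum>w\<le>n. real n * M)" by (intro sum_mono) auto
  then show ?thesis by simp
qed

section \<open>Growth of matrix powers\<close>

text \<open>
  The spectral radius of \<open>A\<^sup>N\<close> is bounded by its maximal row sum: evaluate \<open>A\<^sup>N v = l\<^sup>N v\<close>
  at a coordinate where the eigenvector \<open>v\<close> for a dominant eigenvalue \<open>l\<close> is largest.
\<close>

lemma spectral_radius_power_le:
  assumes A: "A \<in> carrier_mat n n" and n: "n > 0"
    and D: "\<And>i j. i < n \<Longrightarrow> j < n \<Longrightarrow> norm ((A ^\<^sub>m N) $$ (i, j)) \<le> D"
  shows "spectral_radius A ^ N \<le> real n * D"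
proof -
  from spectral_radius_mem_max(1)[OF A n] obtain l where l: "eigenvalue A l" "spectral_radius A = norm l"
    unfolding spectrum_def by auto
  then obtain v where v: "eigenvector A v l" unfolding eigenvalue_def by auto
  have vc: "v \<in> carrier_vec n" and v0: "v \<noteq> 0\<^sub>v n" using v A unfolding eigenvector_def by auto
  have pow: "A ^\<^sub>m N *\<^sub>v v = l ^ N \<cdot>\<^sub>v v" by (rule eigenvector_pow[OF A v])
  define m where "m = Max ((\<lambda>i. norm (v $ i)) ` {..<n})"
  have "m \<in> (\<lambda>i. norm (v $ i)) ` {..<n}" unfolding m_def using n by (intro Max_in) auto
  then obtain i where i: "i < n" "m = norm (v $ i)" by auto
  have le: "norm (v $ j) \<le> m" if "j < n" for j unfolding m_def using that by (intro Max_ge) auto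
  have "m > 0"
  proof (rule ccontr)
    assume "\<not> m > 0"
    then have "v $ j = 0" if "j < n" for j using le[OF that] by (metis norm_le_zero_iff order_trans not_less)
    then have "v = 0\<^sub>v n" using vc by (intro eq_vecI) auto
    with v0 show False ..
  qed
  have D0: "0 \<le> D" using D[OF i(1) i(1)] norm_ge_zero order_trans by blast
  have "norm l ^ N * m = norm ((A ^\<^sub>m N *\<^sub>v v) $ i)"
    using i vc by (simp add: pow norm_mult norm_power)
  also have "(A ^\<^sub>m N *\<^sub>v v) $ i = (\<Sum>j<n. (A ^\<^sub>m N) $$ (i, j) * v $ j)"
    using i A vc by (simp add: scalar_prod_def lessThan_atLeast0)
  also have "norm \<dots> \<le> (\<Sum>j<n. D * m)"
    by (intro sum_norm_le) (use i D D0 le in \<open>auto simp: norm_mult intro!: mult_mono\<close>)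
  also have "\<dots> = real n * D * m" by simp
  finally show ?thesis using \<open>m > 0\<close> l by simp
qed

lemma smult_pow_mat:
  fixes A :: "'a::comm_ring_1 mat"
  assumes A: "A \<in> carrier_mat n n"
  shows "(c \<cdot>\<^sub>m A) ^\<^sub>m N = c ^ N \<cdot>\<^sub>m (A ^\<^sub>m N)"
proof (induction N)
  case 0
  then show ?case by (intro eq_matI) auto
next
  case (Suc N)
  have "A ^\<^sub>m N \<in> carrier_mat n n" using A by simp
  with A Suc have "(c \<cdot>\<^sub>m A) ^\<^sub>m Suc N = c \<cdot>\<^sub>m (c ^ N \<cdot>\<^sub>m (A ^\<^sub>m N * A))"
    by (simp add: mult_smult_distrib[of _ n n _ n] mult_smult_assoc_mat[of _ n n _ n])
  also have "\<dots> = c ^ Suc N \<cdot>\<^sub>m (A ^\<^sub>m Suc N)"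
    by (intro eq_matI) (auto simp: mult.assoc)
  finally show ?case .
qed

text \<open>
  After division by the spectral radius, the Jordan normal form bounds the entries of the powers
  by \<open>c\<^sub>1 + c\<^sub>2 N\<^sup>n\<^sup>-\<^sup>1\<close>. For positive \<open>N\<close> the constant term is absorbed into a multiple of \<open>N\<^sup>n\<^sup>-\<^sup>1\<close>.
\<close>

lemma pow_mat_entries_bound:
  assumes A: "A \<in> carrier_mat n n" and n: "n > 0" and r: "spectral_radius A > 0"
  shows "\<exists>C>0. \<forall>N\<ge>1. \<forall>i<n. \<forall>j<n. norm ((A ^\<^sub>m N) $$ (i, j)) \<le> C * real N ^ (n - 1) * spectral_radius A ^ N"
proof -
  let ?r = "spectral_radius A"
  let ?c = "complex_of_real (inverse ?r)"
  have B: "?c \<cdot>\<^sub>m A \<in> carrier_mat n n" using A by simp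
  have "spectral_radius (?c \<cdot>\<^sub>m A) \<le> 1"
  proof -
    from spectral_radius_mem_max(1)[OF B n] obtain l v
      where l: "eigenvector (?c \<cdot>\<^sub>m A) v l" "spectral_radius (?c \<cdot>\<^sub>m A) = norm l"
      unfolding spectrum_def eigenvalue_def by auto
    have v: "v \<in> carrier_vec n" "v \<noteq> 0\<^sub>v n" "(?c \<cdot>\<^sub>m A) *\<^sub>v v = l \<cdot>\<^sub>v v"
      using l(1) A unfolding eigenvector_def by auto
    have "A *\<^sub>v v = (of_real ?r * l) \<cdot>\<^sub>v v"
    proof (rule eq_vecI)
      fix i assume "i < dim_vec ((of_real ?r * l) \<cdot>\<^sub>v v)"
      then have i: "i < n" using v by simp
      have "?c * (A *\<^sub>v v) $ i = l * v $ i"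
        using arg_cong[OF v(3), of "\<lambda>u. u $ i"] i A v(1)
        by simp
      then show "(A *\<^sub>v v) $ i = ((of_real ?r * l) \<cdot>\<^sub>v v) $ i"
        using i v r by (simp add: field_simps)
    qed (use A v in auto)
    then have "eigenvector A v (of_real ?r * l)" using A v unfolding eigenvector_def by auto
    then have "norm (of_real ?r * l) \<in> norm ` spectrum A"
      unfolding spectrum_def eigenvalue_def by blast
    from spectral_radius_mem_max(2)[OF A n this] have "?r * norm l \<le> ?r" using r
      by (simp add: norm_mult)
    then show ?thesis using r l(2) by simp
  qed
  from spectral_radius_jnf_norm_bound_le_1_upper_triangular[OF B this] obtain c1 c2
    where c: "\<And>k. norm_bound ((?c \<cdot>\<^sub>m A) ^\<^sub>m k) (c1 + c2 * of_nat k ^ (n - 1))" by blast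
  show ?thesis
    \<comment> \<open>The summand 1 makes the constant positive, so that its logarithm can be taken later.\<close>
  proof (intro exI[of _ "\<bar>c1\<bar> + \<bar>c2\<bar> + 1"] conjI allI impI)
    fix N i j :: nat assume N: "N \<ge> 1" and ij: "i < n" "j < n"
    have "norm (((?c \<cdot>\<^sub>m A) ^\<^sub>m N) $$ (i, j)) \<le> c1 + c2 * real N ^ (n - 1)"
      using c[of N] ij carrier_matD[OF pow_carrier_mat[OF B, of N]] unfolding norm_bound_def by metis
    also have "\<dots> \<le> \<bar>c1\<bar> * real N ^ (n - 1) + \<bar>c2\<bar> * real N ^ (n - 1)"
    proof (rule add_mono)
      have "1 \<le> real N ^ (n - 1)" using N by simp
      then show "c1 \<le> \<bar>c1\<bar> * real N ^ (n - 1)" by (metis abs_ge_self abs_ge_zero mult.right_neutral mult_left_mono order_trans)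
      show "c2 * real N ^ (n - 1) \<le> \<bar>c2\<bar> * real N ^ (n - 1)" by (intro mult_right_mono) auto
    qed
    also have "\<dots> \<le> (\<bar>c1\<bar> + \<bar>c2\<bar> + 1) * real N ^ (n - 1)" by (simp add: algebra_simps)
    finally have "norm (((?c \<cdot>\<^sub>m A) ^\<^sub>m N) $$ (i, j)) \<le> (\<bar>c1\<bar> + \<bar>c2\<bar> + 1) * real N ^ (n - 1)" .
    moreover have "norm (((?c \<cdot>\<^sub>m A) ^\<^sub>m N) $$ (i, j)) = norm ((A ^\<^sub>m N) $$ (i, j)) / ?r ^ N"
      using ij A r unfolding smult_pow_mat[OF A]
      by (simp add: norm_mult norm_power power_inverse divide_inverse norm_inverse)
    ultimately show "norm ((A ^\<^sub>m N) $$ (i, j)) \<le> (\<bar>c1\<bar> + \<bar>c2\<bar> + 1) * real N ^ (n - 1) * ?r ^ N"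
      using r by (simp add: divide_le_eq)
  qed simp
qed

text \<open>
  Constant and polynomial factors do not change an exponential growth rate.
\<close>

lemma ln_over_n_tendsto:
  fixes D :: "nat \<Rightarrow> real"
  assumes r: "r > 0" and K: "K > 0" and C: "C > 0"
    and lower: "\<And>N. N \<ge> 1 \<Longrightarrow> r ^ N \<le> K * D N"
    and upper: "\<And>N. N \<ge> 1 \<Longrightarrow> D N \<le> C * real N ^ m * r ^ N"
  shows "(\<lambda>N. ln (D N) / real N) \<longlonglongrightarrow> ln r"
proof (rule tendsto_sandwich)
  have ln_over_n: "(\<lambda>N. ln (real N) / real N) \<longlonglongrightarrow> 0"
    by (rule filterlim_compose[OF ln_x_over_x_tendsto_0 filterlim_real_sequentially])
  have inv: "(\<lambda>N. c / real N) \<longlonglongrightarrow> 0" for c by (rule lim_const_over_n)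
  show "(\<lambda>N. ln r - ln K / real N) \<longlonglongrightarrow> ln r"
    using tendsto_diff[OF tendsto_const inv[of "ln K"], of "ln r"] by simp
  show "(\<lambda>N. ln r + ln C / real N + real m * (ln (real N) / real N)) \<longlonglongrightarrow> ln r"
    using tendsto_add[OF tendsto_add[OF tendsto_const inv[of "ln C"], of "ln r"]
        tendsto_mult_right[OF ln_over_n, of "real m"]] by (simp add: mult.commute)
  have D: "D N > 0" if "N \<ge> 1" for N
    using lower[OF that] r K by (metis less_le_trans zero_less_mult_pos zero_less_power)
  show "\<forall>\<^sub>F N in sequentially. ln r - ln K / real N \<le> ln (D N) / real N"
    using eventually_ge_at_top[of 1]
  proof eventually_elim
    case (elim N)
    have "ln (r ^ N) \<le> ln (K * D N)" using lower[OF elim] r by (intro ln_mono) auto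
    also have "\<dots> = ln K + ln (D N)" using K D[OF elim] by (simp add: ln_mult)
    finally have "real N * ln r \<le> ln K + ln (D N)" using r by (simp add: ln_realpow)
    then have "ln r \<le> (ln K + ln (D N)) / real N" using elim by (simp add: le_divide_eq mult.commute)
    then show ?case by (simp add: add_divide_distrib)
  qed
  show "\<forall>\<^sub>F N in sequentially. ln (D N) / real N \<le> ln r + ln C / real N + real m * (ln (real N) / real N)"
    using eventually_ge_at_top[of 1]
  proof eventually_elim
    case (elim N)
    have "ln (D N) \<le> ln (C * real N ^ m * r ^ N)" using upper[OF elim] D[OF elim] by (rule ln_mono)
    also have "\<dots> = ln C + real m * ln (real N) + real N * ln r"
      using C r elim by (simp add: ln_mult ln_realpow)
    finally show ?case using elim by (simp add: field_simps)
  qed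
qed

section \<open>The spectral radius of an integer matrix is an algebraic integer\<close>

lemma algebraic_int_eigenvalue:
  fixes A :: "int mat" and l :: complex
  assumes A: "A \<in> carrier_mat n n" and l: "eigenvalue (map_mat of_int A) l"
  shows "algebraic_int l"
proof -
  have "char_poly (map_mat of_int A :: complex mat) = map_poly of_int (char_poly A)"
    by (rule of_int_hom.char_poly_hom[OF A])
  moreover have "poly (char_poly (map_mat of_int A)) l = 0"
    using l A eigenvalue_root_char_poly[of "map_mat of_int A" n l] by simp
  moreover have "lead_coeff (char_poly A) = 1" using degree_monic_char_poly[OF A] by simp
  ultimately show ?thesis unfolding algebraic_int_altdef_ipoly by metis
qed

text \<open>
  Pairs of indices are encoded as \<open>i * n + j\<close>. The eigenvalues of the Kronecker product include the
  products of eigenvalues of the factors, which shows that such products are algebraic integers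
  when both factors are integer matrices.
\<close>

definition kronecker_mat :: "nat \<Rightarrow> 'a::semiring_1 mat \<Rightarrow> 'a mat \<Rightarrow> 'a mat" where
  "kronecker_mat n A B = mat (n * n) (n * n) (\<lambda>(i, j). A $$ (i div n, j div n) * B $$ (i mod n, j mod n))"

lemma sum_div_mod:
  fixes f :: "nat \<Rightarrow> nat \<Rightarrow> 'a::comm_monoid_add"
  shows "(\<Sum>i<m * n. f (i div n) (i mod n)) = (\<Sum>a<m. \<Sum>b<n. f a b)"
proof -
  have "(\<Sum>b\<in>{a * n..<a * n + n}. f (b div n) (b mod n)) = (\<Sum>b<n. f a b)" for a
  proof -
    have "(\<Sum>b\<in>{a * n..<a * n + n}. f (b div n) (b mod n)) =
        (\<Sum>b\<in>{0..<n}. f ((b + a * n) div n) ((b + a * n) mod n))"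
      using sum.shift_bounds_nat_ivl[of "\<lambda>b. f (b div n) (b mod n)" 0 "a * n" n]
      by (simp add: add.commute)
    then show ?thesis by (simp add: lessThan_atLeast0)
  qed
  then show ?thesis
    using sum.nat_group[of "\<lambda>i. f (i div n) (i mod n)" n m] by simp
qed

lemma eigenvalue_kronecker_mat:
  fixes A B :: "'a::field mat"
  assumes A: "A \<in> carrier_mat n n" and B: "B \<in> carrier_mat n n"
    and l: "eigenvalue A l" and m: "eigenvalue B m"
  shows "eigenvalue (kronecker_mat n A B) (l * m)"
proof -
  from l m obtain u v where "eigenvector A u l" "eigenvector B v m" unfolding eigenvalue_def by auto
  then have u: "u \<in> carrier_vec n" "u \<noteq> 0\<^sub>v n" "A *\<^sub>v u = l \<cdot>\<^sub>v u"
    and v: "v \<in> carrier_vec n" "v \<noteq> 0\<^sub>v n" "B *\<^sub>v v = m \<cdot>\<^sub>v v"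
    using A B unfolding eigenvector_def by auto
  define w where "w = vec (n * n) (\<lambda>i. u $ (i div n) * v $ (i mod n))"
  obtain a where a: "a < n" "u $ a \<noteq> 0" using u by (metis carrier_vecD eq_vecI index_zero_vec)
  obtain b where b: "b < n" "v $ b \<noteq> 0" using v by (metis carrier_vecD eq_vecI index_zero_vec)
  have ab: "a * n + b < n * n"
  proof -
    have "a * n + b < Suc a * n" using b by simp
    also have "\<dots> \<le> n * n" using a by (intro mult_right_mono) auto
    finally show ?thesis .
  qed
  have "w $ (a * n + b) \<noteq> 0" using a b ab by (simp add: w_def)
  then have w0: "w \<noteq> 0\<^sub>v (n * n)" using ab by auto
  have "kronecker_mat n A B *\<^sub>v w = (l * m) \<cdot>\<^sub>v w"
  proof (rule eq_vecI)
    fix i assume "i < dim_vec ((l * m) \<cdot>\<^sub>v w)"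
    then have i: "i < n * n" by (simp add: w_def)
    have n0: "n > 0" using a by simp
    have i1: "i div n < n" using i by (simp add: less_mult_imp_div_less)
    have i2: "i mod n < n" using n0 by simp
    have Au: "(\<Sum>j<n. A $$ (i div n, j) * u $ j) = l * u $ (i div n)"
      using arg_cong[OF u(3), of "\<lambda>x. x $ (i div n)"] A u(1) i1
      by (simp add: scalar_prod_def lessThan_atLeast0)
    have Bv: "(\<Sum>j<n. B $$ (i mod n, j) * v $ j) = m * v $ (i mod n)"
      using arg_cong[OF v(3), of "\<lambda>x. x $ (i mod n)"] B v(1) i2
      by (simp add: scalar_prod_def lessThan_atLeast0)
    have "(kronecker_mat n A B *\<^sub>v w) $ i =
        (\<Sum>j<n * n. (A $$ (i div n, j div n) * u $ (j div n)) * (B $$ (i mod n, j mod n) * v $ (j mod n)))"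
      using i by (simp add: kronecker_mat_def w_def scalar_prod_def lessThan_atLeast0 ac_simps)
    also have "\<dots> = (\<Sum>j<n. A $$ (i div n, j) * u $ j) * (\<Sum>j<n. B $$ (i mod n, j) * v $ j)"
      unfolding sum_div_mod[of "\<lambda>a b. (A $$ (i div n, a) * u $ a) * (B $$ (i mod n, b) * v $ b)"]
      by (simp add: sum_product)
    finally show "(kronecker_mat n A B *\<^sub>v w) $ i = ((l * m) \<cdot>\<^sub>v w) $ i"
      using i by (simp add: Au Bv w_def)
  qed (simp add: kronecker_mat_def w_def)
  then have "eigenvector (kronecker_mat n A B) w (l * m)"
    using w0 by (simp add: eigenvector_def kronecker_mat_def w_def)
  then show ?thesis unfolding eigenvalue_def by blast
qed

lemma eigenvalue_cnj:
  fixes A :: "int mat" and l :: complex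
  assumes A: "A \<in> carrier_mat n n" and l: "eigenvalue (map_mat of_int A) l"
  shows "eigenvalue (map_mat of_int A) (cnj l)"
proof -
  let ?A = "map_mat of_int A :: complex mat"
  from l obtain u where "eigenvector ?A u l" unfolding eigenvalue_def by auto
  then have u: "u \<in> carrier_vec n" "u \<noteq> 0\<^sub>v n" "?A *\<^sub>v u = l \<cdot>\<^sub>v u"
    using A unfolding eigenvector_def by auto
  let ?w = "map_vec cnj u"
  have "?A *\<^sub>v ?w = cnj l \<cdot>\<^sub>v ?w"
  proof (rule eq_vecI)
    fix i assume "i < dim_vec (cnj l \<cdot>\<^sub>v ?w)"
    then have i: "i < n" using u by simp
    have "(\<Sum>j<n. of_int (A $$ (i, j)) * u $ j) = l * u $ i"
      using arg_cong[OF u(3), of "\<lambda>x. x $ i"] A u(1) i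
      by (simp add: scalar_prod_def lessThan_atLeast0)
    from arg_cong[OF this, of cnj]
    show "(?A *\<^sub>v ?w) $ i = (cnj l \<cdot>\<^sub>v ?w) $ i"
      using A u(1) i by (simp add: scalar_prod_def lessThan_atLeast0)
  qed (use A u in auto)
  moreover have "?w \<noteq> 0\<^sub>v n"
  proof
    assume *: "?w = 0\<^sub>v n"
    have "u = 0\<^sub>v n"
    proof (rule eq_vecI)
      fix i assume "i < dim_vec (0\<^sub>v n :: complex vec)"
      then show "u $ i = 0\<^sub>v n $ i" using arg_cong[OF *, of "\<lambda>x. x $ i"] u(1) by simp
    qed (use u in auto)
    with u show False by simp
  qed
  ultimately have "eigenvector ?A ?w (cnj l)" using A u by (simp add: eigenvector_def)
  then show ?thesis unfolding eigenvalue_def by blast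
qed

text \<open>
  The matrix is real, so the conjugate of a dominant eigenvalue \<open>l\<close> is an eigenvalue, and the square
  \<open>l * cnj l\<close> of its modulus is an eigenvalue of the Kronecker product of \<open>A\<close> with itself, which is
  an integer matrix.
\<close>

lemma algebraic_int_spectral_radius:
  fixes A :: "int mat"
  assumes A: "A \<in> carrier_mat n n" and n: "n > 0"
  shows "algebraic_int (spectral_radius (map_mat of_int A))"
proof -
  let ?A = "map_mat of_int A :: complex mat"
  have A': "?A \<in> carrier_mat n n" using A by simp
  from spectral_radius_mem_max(1)[OF A' n] obtain l where l: "eigenvalue ?A l" "spectral_radius ?A = norm l"
    unfolding spectrum_def by auto
  have "eigenvalue (kronecker_mat n ?A ?A) (l * cnj l)"
    by (rule eigenvalue_kronecker_mat[OF A' A' l(1) eigenvalue_cnj[OF A l(1)]])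
  also have "kronecker_mat n ?A ?A = map_mat of_int (kronecker_mat n A A)"
  proof (rule eq_matI)
    fix i j assume "i < dim_row (map_mat of_int (kronecker_mat n A A) :: complex mat)"
      "j < dim_col (map_mat of_int (kronecker_mat n A A) :: complex mat)"
    then have ij: "i < n * n" "j < n * n" by (simp_all add: kronecker_mat_def)
    then have "i div n < n" "j div n < n" "i mod n < n" "j mod n < n"
      using n by (simp_all add: less_mult_imp_div_less)
    then show "kronecker_mat n ?A ?A $$ (i, j) = map_mat of_int (kronecker_mat n A A) $$ (i, j)"
      using A ij by (simp add: kronecker_mat_def)
  qed (simp_all add: kronecker_mat_def)
  finally have "algebraic_int (l * cnj l)"
    using algebraic_int_eigenvalue[of "kronecker_mat n A A" "n * n"] by (simp add: kronecker_mat_def)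
  then have "algebraic_int (complex_of_real ((norm l)\<^sup>2))"
    by (simp only: complex_norm_square)
  then have "algebraic_int ((norm l)\<^sup>2)" by (simp only: algebraic_int_of_real_iff)
  then have "algebraic_int (sqrt ((norm l)\<^sup>2))" by (rule algebraic_int_sqrt)
  then show ?thesis using l(2) by simp
qed

text \<open>
  A nonsingular matrix does not have the eigenvalue zero.
\<close>

lemma spectral_radius_pos:
  fixes A :: "int mat"
  assumes A: "A \<in> carrier_mat n n" and n: "n > 0" and det: "det A \<noteq> 0"
  shows "spectral_radius (map_mat of_int A) > 0"
proof -
  let ?A = "map_mat of_int A :: complex mat"
  have A': "?A \<in> carrier_mat n n" using A by simp
  from spectral_radius_mem_max(1)[OF A' n] obtain l v
    where l: "eigenvector ?A v l" "spectral_radius ?A = norm l"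
    unfolding spectrum_def eigenvalue_def by auto
  have "l \<noteq> 0"
  proof
    assume "l = 0"
    then have "v \<in> carrier_vec n" "v \<noteq> 0\<^sub>v n" "?A *\<^sub>v v = 0\<^sub>v n"
      using l(1) A unfolding eigenvector_def by auto
    then have "det ?A = 0" using det_0_iff_vec_prod_zero[OF A'] by blast
    with det show False by (simp add: of_int_hom.hom_det)
  qed
  with l(2) show ?thesis by simp
qed

section \<open>The algebraic entropy of monomial maps\<close>

theorem corollary6p4:
  fixes n :: nat and A :: "int mat"
  assumes "n \<ge> 1" and "A \<in> carrier_mat n n" and "det A \<noteq> 0"
  shows "\<exists>\<alpha>::real. algebraic_int \<alpha> \<and> \<alpha> > 0 \<and> has_algebraic_entropy n (monomial_map n A) (ln \<alpha>)"
proof -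
  let ?A = "map_mat of_int A :: complex mat"
  let ?r = "spectral_radius ?A"
  let ?D = "\<lambda>N. \<Sum>v\<le>n. denom_exp n (A ^\<^sub>m N) v"
  have n: "n > 0" and A: "A \<in> carrier_mat n n" and A': "?A \<in> carrier_mat n n" using assms by auto
  have r: "?r > 0" by (rule spectral_radius_pos[OF A n assms(3)])
  have entry: "norm ((?A ^\<^sub>m N) $$ (i, j)) = real_of_int \<bar>(A ^\<^sub>m N) $$ (i, j)\<bar>"
    if "i < n" "j < n" for N i j
  proof -
    have "?A ^\<^sub>m N = map_mat of_int (A ^\<^sub>m N)" by (rule of_int_hom.mat_hom_pow[OF A, symmetric])
    then show ?thesis using that A by simp
  qed
  obtain C where C: "C > 0" and upper: "\<And>N i j. N \<ge> 1 \<Longrightarrow> i < n \<Longrightarrow> j < n \<Longrightarrow>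
      norm ((?A ^\<^sub>m N) $$ (i, j)) \<le> C * real N ^ (n - 1) * ?r ^ N"
    using pow_mat_entries_bound[OF A' n r] by blast
  have "(\<lambda>N. ln (real (?D N)) / real N) \<longlonglongrightarrow> ln ?r"
  proof (rule ln_over_n_tendsto[OF r])
    show "real n > 0" "real (Suc n) * real n * C > 0" using n C by simp_all
    fix N :: nat assume N: "N \<ge> 1"
    show "?r ^ N \<le> real n * real (?D N)"
    proof (rule spectral_radius_power_le[OF A' n])
      fix i j assume ij: "i < n" "j < n"
      have "\<bar>(A ^\<^sub>m N) $$ (i, j)\<bar> \<le> int (?D N)"
        using laurent_exp_le_sum_denom[of i n j "A ^\<^sub>m N"] ij by (simp add: laurent_exp_def)
      then have "real_of_int \<bar>(A ^\<^sub>m N) $$ (i, j)\<bar> \<le> real_of_int (int (?D N))"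
        by (rule of_int_le_iff[THEN iffD2])
      then show "norm ((?A ^\<^sub>m N) $$ (i, j)) \<le> real (?D N)"
        unfolding entry[OF ij] by simp
    qed
    have "real (?D N) \<le> real (Suc n) * (real n * (C * real N ^ (n - 1) * ?r ^ N))"
    proof (rule sum_denom_le[OF _ assms(1)])
      fix i j assume ij: "i < n" "j < n"
      show "real_of_int \<bar>(A ^\<^sub>m N) $$ (i, j)\<bar> \<le> C * real N ^ (n - 1) * ?r ^ N"
        using upper[OF N ij] unfolding entry[OF ij] .
    qed
    then show "real (?D N) \<le> real (Suc n) * real n * C * real N ^ (n - 1) * ?r ^ N"
      by (simp only: mult.assoc)
  qed
  then have "has_algebraic_entropy n (monomial_map n A) (ln ?r)"
    unfolding has_algebraic_entropy_def by (simp only: ratmap_degree_iter_monomial_map[OF A])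
  then show ?thesis using algebraic_int_spectral_radius[OF A n] r by blast
qed

end
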